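(* Assume that NCF holds. Then every Scheepers space is $U$-Menger for all ultrafilters $U$. Consequently, the properties $U$-Menger are equivalent for all ultrafilters $U$ (that is, for any two ultrafilters $U$ and $V$, a space is $U$-Menger if and only if it is $V$-Menger).
   Context: A space is an infinite Tychonoff topological space. An ultrafilter means a free ultrafilter on $\omega$. Ultrafilters $U,U'$ are nearly coherent if there exists a finite-to-one map $\varphi\colon\omega\to\omega$ such that $\varphi[U]=\varphi[U']$, where $\varphi[U]=\{\varphi[u] : u\in U\}$. NCF (near coherence of filters) is the statement that any two ultrafilters on $\omega$ are nearly coherent. A space $X$ is Scheepers if for every sequence $\mathcal{U}_0,\mathcal{U}_1,\dots$ of open covers of $X$ there are finite sets $\mathcal{F}_0\subseteq\mathcal{U}_0,\mathcal{F}_1\subseteq\mathcal{U}_1,\dots$ such that for every finite $F\subseteq X$ there is $n$ with $F\subseteq\bigcup\mathcal{F}_n$. For an ultrafilter $U$, a space $X$ is $U$-Menger if for every sequence $\mathcal{U}_0,\mathcal{U}_1,\dots$ of open covers of $X$ there are finite sets $\mathcal{F}_0\subseteq\mathcal{U}_0,\mathcal{F}_1\subseteq\mathcal{U}_1,\dots$ such that $\{n : x\in\bigcup\mathcal{F}_n\}\in U$ for all $x\in X$. *)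

theory Defs
  imports "HOL-Analysis.Analysis"
begin

text \<open>
  Ultrafilters are represented by the library type \<^typ>\<open>nat filter\<close>;
  a set \<open>A\<close> is a member of \<open>U\<close> iff \<open>eventually (\<lambda>n. n \<in> A) U\<close>. The last conjunct says that
  \<open>U\<close> is free: in the order on filters it means that every cofinite set belongs to \<open>U\<close>.
\<close>

definition free_ultrafilter :: "nat filter \<Rightarrow> bool" where
  "free_ultrafilter U \<longleftrightarrow>
     U \<noteq> bot \<and>
     (\<forall>P. eventually P U \<or> eventually (\<lambda>n. \<not> P n) U) \<and>
     U \<le> cofinite"

definition members :: "nat filter \<Rightarrow> nat set set" where
  "members U = {A. eventually (\<lambda>n. n \<in> A) U}"

definition finite_to_one :: "(nat \<Rightarrow> nat) \<Rightarrow> bool" where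
  "finite_to_one \<phi> \<longleftrightarrow> (\<forall>n. finite (\<phi> -` {n}))"

text \<open>
  The family of images \<open>\<phi>[u]\<close>, \<open>u \<in> U\<close>, is taken literally, without closing it under
  supersets; so it is not \<^const>\<open>filtermap\<close>, which is the filter it generates.
\<close>

definition nearly_coherent :: "nat filter \<Rightarrow> nat filter \<Rightarrow> bool" where
  "nearly_coherent U V \<longleftrightarrow>
     (\<exists>\<phi>. finite_to_one \<phi> \<and> (\<lambda>u. \<phi> ` u) ` members U = (\<lambda>v. \<phi> ` v) ` members V)"

definition NCF :: bool where
  "NCF \<longleftrightarrow> (\<forall>U V. free_ultrafilter U \<longrightarrow> free_ultrafilter V \<longrightarrow> nearly_coherent U V)"

definition infinite_Tychonoff_space :: "'a topology \<Rightarrow> bool" where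
  "infinite_Tychonoff_space X \<longleftrightarrow>
     infinite (topspace X) \<and> completely_regular_space X \<and> Hausdorff_space X"

definition open_cover :: "'a topology \<Rightarrow> 'a set set \<Rightarrow> bool" where
  "open_cover X \<U> \<longleftrightarrow> (\<forall>G\<in>\<U>. openin X G) \<and> \<Union>\<U> = topspace X"

definition Scheepers_space :: "'a topology \<Rightarrow> bool" where
  "Scheepers_space X \<longleftrightarrow>
     (\<forall>\<U> :: nat \<Rightarrow> 'a set set. (\<forall>n. open_cover X (\<U> n)) \<longrightarrow>
       (\<exists>\<F>. (\<forall>n. finite (\<F> n) \<and> \<F> n \<subseteq> \<U> n) \<and>
            (\<forall>F. finite F \<and> F \<subseteq> topspace X \<longrightarrow> (\<exists>n. F \<subseteq> \<Union>(\<F> n)))))"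

definition Menger_wrt :: "nat filter \<Rightarrow> 'a topology \<Rightarrow> bool" where
  "Menger_wrt U X \<longleftrightarrow>
     (\<forall>\<U> :: nat \<Rightarrow> 'a set set. (\<forall>n. open_cover X (\<U> n)) \<longrightarrow>
       (\<exists>\<F>. (\<forall>n. finite (\<F> n) \<and> \<F> n \<subseteq> \<U> n) \<and>
            (\<forall>x\<in>topspace X. {n. x \<in> \<Union>(\<F> n)} \<in> members U)))"

end

theory Submission
  imports Defs "HOL-Algebra.Free_Abelian_Groups"
begin

text \<open>
  Write \<open>\<dd>\<close> for the dominating number. NCF implies that for every ultrafilter \<open>U\<close> there are fewer
  than \<open>\<dd>\<close> functions \<open>h\<close> such that each \<open>A \<in> U\<close> meets almost all intervals \<open>[n, h n]\<close> for
  one of them: otherwise a recursion of length \<open>\<dd>\<close> yields an ultrafilter not nearly coherent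
  to \<open>U\<close>. Hence a family of increasing functions that is bounded modulo one ultrafilter is
  dominated by fewer than \<open>\<dd>\<close> functions; if these were unbounded modulo another ultrafilter \<open>U\<close>,
  then composing them with the functions \<open>h\<close> for \<open>U\<close> would give fewer than \<open>\<dd>\<close> dominating
  functions. So boundedness does not depend on the ultrafilter. For a sequence of covers, the
  Scheepers property makes the functions sending \<open>n\<close> to the first stage at which \<open>x\<close> is covered
  bounded modulo some ultrafilter, while \<open>U\<close>-Menger means that they are bounded modulo \<open>U\<close>.
\<close>

section \<open>Ultrafilters\<close>

text \<open>Zorn gives a minimal proper filter below \<open>F\<close>. Adjoining \<open>P\<close> to
  it either yields \<open>bot\<close> or, by minimality, changes nothing, so it decides every
  \<open>P\<close>.\<close>

lemma ultrafilter_below: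
  fixes F :: "'a filter"
  assumes "F \<noteq> bot"
  obtains U where "U \<le> F" "U \<noteq> bot" "\<And>P. eventually P U \<or> eventually (\<lambda>n. \<not> P n) U"
proof -
  define A where "A = {G. G \<le> F \<and> G \<noteq> bot}"
  have "\<exists>U\<in>A. \<forall>G\<in>A. G \<le> U \<longrightarrow> G = U"
  proof (rule predicate_Zorn[where P = "\<lambda>x y. y \<le> x" and A = A])
    show "partial_order_on A (relation_of (\<lambda>x y. y \<le> x) A)"
      by (intro partial_order_on_relation_ofI) auto
  next
    fix C assume C: "C \<in> Chains (relation_of (\<lambda>x y. y \<le> x) A)"
    have CA: "C \<subseteq> A"
      using C by (auto simp: Chains_def relation_of_def)
    have lin: "x \<le> y \<or> y \<le> x" if "x \<in> C" "y \<in> C" for x y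
      using C that by (auto simp: Chains_def relation_of_def)
    show "\<exists>u\<in>A. \<forall>a\<in>C. u \<le> a"
    proof (cases "C = {}")
      case True
      then show ?thesis using assms by (auto simp: A_def)
    next
      case False
      have "eventually P (Inf C) \<longleftrightarrow> (\<exists>b\<in>C. eventually P b)" for P
        using lin by (intro eventually_Inf_base[OF False]) fastforce
      then have "Inf C \<noteq> bot"
        using CA by (auto simp: A_def trivial_limit_def)
      moreover have "Inf C \<le> F"
        using False CA by (auto simp: A_def intro: Inf_lower2)
      ultimately show ?thesis
        by (intro bexI[of _ "Inf C"]) (auto simp: A_def Inf_lower)
    qed
  qed
  then obtain U where U: "U \<le> F" "U \<noteq> bot" and
    min: "\<And>G. G \<le> U \<Longrightarrow> G \<noteq> bot \<Longrightarrow> G = U"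
    unfolding A_def by (blast intro: order_trans)
  have "eventually P U \<or> eventually (\<lambda>n. \<not> P n) U" for P
  proof (cases "inf U (principal {n. P n}) = bot")
    case True
    then have "eventually (\<lambda>n. \<not> P n) U"
      by (simp add: trivial_limit_def eventually_inf_principal)
    then show ?thesis ..
  next
    case False
    then have "inf U (principal {n. P n}) = U"
      by (intro min) auto
    moreover have "eventually P (inf U (principal {n. P n}))"
      by (simp add: eventually_inf_principal)
    ultimately have "eventually P U" by simp
    then show ?thesis ..
  qed
  with U that show ?thesis by blast
qed

text \<open>The sets \<open>E i\<close> are adjoined to \<open>cofinite\<close>, which makes the
  ultrafilter free; infinite finite intersections keep the resulting filter proper.\<close>

lemma free_ultrafilter_extends:
  fixes E :: "'i \<Rightarrow> nat set"
  assumes inf: "\<And>T. finite T \<Longrightarrow> T \<subseteq> I \<Longrightarrow> infinite (\<Inter>i\<in>T. E i)"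
  shows "\<exists>U. free_ultrafilter U \<and> (\<forall>i\<in>I. eventually (\<lambda>n. n \<in> E i) U)"
proof -
  define G where "G T = inf cofinite (principal (\<Inter>i\<in>T. E i))" for T
  define F where "F = (INF T\<in>Fpow I. G T)"
  have "eventually P F \<longleftrightarrow> (\<exists>T\<in>Fpow I. eventually P (G T))" for P
    unfolding F_def
  proof (rule eventually_INF_base)
    fix S T assume "S \<in> Fpow I" "T \<in> Fpow I"
    then show "\<exists>x\<in>Fpow I. G x \<le> inf (G S) (G T)"
      by (intro bexI[of _ "S \<union> T"]) (auto simp: G_def Fpow_def intro: le_infI2)
  qed (auto simp: Fpow_def)
  moreover have "\<not> eventually (\<lambda>_. False) (G T)" if "T \<in> Fpow I" for T
    using inf[of T] that
    by (simp add: G_def Fpow_def eventually_inf_principal eventually_cofinite INTER_eq)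
  ultimately have "F \<noteq> bot"
    by (auto simp: trivial_limit_def)
  then obtain U where U: "U \<le> F" "U \<noteq> bot" "\<And>P. eventually P U \<or> eventually (\<lambda>n. \<not> P n) U"
    by (rule ultrafilter_below) blast
  have "F \<le> G {}"
    unfolding F_def by (intro INF_lower) (auto simp: Fpow_def)
  then have "U \<le> cofinite"
    using U(1) by (simp add: G_def)
  moreover have "eventually (\<lambda>n. n \<in> E i) U" if "i \<in> I" for i
  proof -
    have "F \<le> G {i}"
      unfolding F_def using that by (intro INF_lower) (auto simp: Fpow_def)
    moreover have "eventually (\<lambda>n. n \<in> E i) (G {i})"
      by (simp add: G_def eventually_inf_principal)
    ultimately show ?thesis
      using U(1) by (auto simp: le_filter_def)
  qed
  ultimately show ?thesis
    using U by (auto simp: free_ultrafilter_def)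
qed

lemma free_ultrafilter_ge:
  assumes "free_ultrafilter U"
  shows "eventually (\<lambda>n. N \<le> n) U"
  using assms eventually_ge_at_top[of N]
  unfolding free_ultrafilter_def le_filter_def cofinite_eq_sequentially by blast

section \<open>Dominating families\<close>

definition dominating :: "(nat \<Rightarrow> nat) set \<Rightarrow> bool" where
  "dominating D \<longleftrightarrow> (\<forall>p. \<exists>f\<in>D. \<forall>\<^sub>F n in sequentially. p n \<le> f n)"

text \<open>The cardinality of \<open>S\<close> is less than the dominating number \<open>\<dd>\<close>.\<close>

definition small :: "'a set \<Rightarrow> bool" where
  "small S \<longleftrightarrow> (\<forall>D. dominating D \<longrightarrow> |S| <o |D| )"

text \<open>One plus the pointwise sum of a finite family lies above each of its members
  everywhere.\<close>

lemma infinite_dominating: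
  assumes "dominating D"
  shows "infinite D"
proof
  assume fin: "finite D"
  obtain f where f: "f \<in> D" "\<forall>\<^sub>F n in sequentially. Suc (\<Sum>f\<in>D. f n) \<le> f n"
    using assms unfolding dominating_def by fast
  have "f n < Suc (\<Sum>f\<in>D. f n)" for n
    using member_le_sum[of f D "\<lambda>f. f n"] fin f(1) by (simp add: less_Suc_eq_le)
  then show False
    using f(2) by (auto simp: not_le[symmetric] eventually_sequentially)
qed

text \<open>\<open>D\<close> realises \<dd>; the minimum exists because cardinals are
  well-ordered.\<close>

lemma minimal_dominating:
  obtains D where "dominating D" "\<And>S :: 'a set. |S| <o |D| \<Longrightarrow> small S"
proof -
  have "dominating UNIV"
    unfolding dominating_def by (blast intro: always_eventually)
  then obtain D where D: "dominating D" "\<And>D'. dominating D' \<Longrightarrow> |D| \<le>o |D'|"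
    using exists_minim_Card_order[of "card_of ` Collect dominating"] by auto
  then show ?thesis
    using that[of D] by (auto simp: small_def intro: ordLess_ordLeq_trans)
qed

lemma small_not_dominating: "small D \<Longrightarrow> \<not> dominating D"
  using ordLess_irreflexive by (auto simp: small_def)

lemma small_image: "small S \<Longrightarrow> small (f ` S)"
  unfolding small_def using card_of_image ordLeq_ordLess_trans by blast

lemma small_Times: "small S \<Longrightarrow> small T \<Longrightarrow> small (S \<times> T)"
  unfolding small_def by (simp add: card_of_Times_ordLess_infinite infinite_dominating)

lemma small_Fpow:
  assumes "small S"
  shows "small (Fpow S)"
proof (cases "finite S")
  case True
  then have "finite (Fpow S)"
    by (simp add: Fpow_Pow_finite)
  then show ?thesis
    unfolding small_def using infinite_dominating finite_ordLess_infinite2 by blast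
next
  case False
  then show ?thesis
    using assms card_of_Fpow_infinite ordIso_ordLess_trans unfolding small_def by blast
qed

definition running_max :: "(nat \<Rightarrow> nat) \<Rightarrow> nat \<Rightarrow> nat" where
  "running_max f n = Max (f ` {..n})"

lemma le_running_max: "m \<le> n \<Longrightarrow> f m \<le> running_max f n"
  unfolding running_max_def by (intro Max_ge) auto

lemma mono_running_max: "m \<le> n \<Longrightarrow> running_max f m \<le> running_max f n"
  unfolding running_max_def by (intro Max_mono) auto

section \<open>Consequences of near coherence\<close>

text \<open>That \<open>h\<close> works for \<open>A\<close> means that it eventually bounds the map
  from \<open>n\<close> to the next element of \<open>A\<close>. So fewer than \<dd> functions
  dominate all next-element maps of \<open>U\<close>.\<close>

definition small_gaps :: "nat filter \<Rightarrow> bool" where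
  "small_gaps U \<longleftrightarrow> (\<exists>H. small H \<and>
     (\<forall>A. eventually (\<lambda>n. n \<in> A) U \<longrightarrow>
       (\<exists>h\<in>H. \<forall>\<^sub>F n in sequentially. \<exists>a\<in>A. n \<le> a \<and> a \<le> h n)))"

text \<open>Closeness is symmetric, as points of one fibre bound each other; the increasing majorant
  lets a large \<open>running_max f a\<close> force a large \<open>a\<close>.\<close>

definition nbhd :: "(nat \<Rightarrow> nat) \<Rightarrow> nat set \<Rightarrow> nat set" where
  "nbhd f A = {m. \<exists>a\<in>A. m \<le> running_max f a \<and> a \<le> running_max f m}"

text \<open>Points in the same fibre of a finite-to-one map are \<open>nbhd f\<close>-close once \<open>f\<close>
  dominates the map sending a point to the maximum of its fibre.\<close>

lemma nearly_coherent_nbhd: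
  assumes "nearly_coherent U V" "free_ultrafilter U" "free_ultrafilter V" "dominating D"
  obtains f where "f \<in> D"
    "\<And>A. eventually (\<lambda>n. n \<in> A) U \<Longrightarrow> \<not> eventually (\<lambda>n. n \<in> - nbhd f A) V"
proof -
  obtain \<phi> :: "nat \<Rightarrow> nat" where fin: "\<And>n. finite (\<phi> -` {n})"
    and eq: "(\<lambda>u. \<phi> ` u) ` members U = (\<lambda>v. \<phi> ` v) ` members V"
    using assms(1) unfolding nearly_coherent_def finite_to_one_def by (elim exE conjE) metis
  define t where "t n = Max (\<phi> -` {\<phi> n})" for n
  have t: "m \<le> t n" if "\<phi> m = \<phi> n" for m n
    unfolding t_def using fin that by (intro Max_ge) auto
  obtain f where "f \<in> D" "\<forall>\<^sub>F n in sequentially. t n \<le> f n"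
    using assms(4)[unfolded dominating_def, THEN spec, of t] by blast
  then obtain N where f: "f \<in> D" "\<And>n. N \<le> n \<Longrightarrow> t n \<le> f n"
    unfolding eventually_sequentially by blast
  have le: "m \<le> running_max f n" if "\<phi> m = \<phi> n" "N \<le> n" for m n
    using t[OF that(1)] f(2)[OF that(2)] le_running_max[of n n f] by linarith
  have "\<not> eventually (\<lambda>n. n \<in> - nbhd f A) V" if A: "eventually (\<lambda>n. n \<in> A) U" for A
  proof
    assume C: "eventually (\<lambda>n. n \<in> - nbhd f A) V"
    \<comment> \<open>\<open>f\<close> bounds \<open>t\<close> only from \<open>N\<close> on, so
      both partners in a common fibre must be at least \<open>N\<close>.\<close>
    have "{a \<in> A. N \<le> a} \<in> members U"
      using A free_ultrafilter_ge[OF assms(2), of N] by (simp add: members_def eventually_conj)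
    then have "\<phi> ` {a \<in> A. N \<le> a} \<in> (\<lambda>v. \<phi> ` v) ` members V"
      unfolding eq[symmetric] by (rule imageI)
    then obtain B where B: "B \<in> members V" "\<phi> ` {a \<in> A. N \<le> a} = \<phi> ` B"
      by (elim imageE) (rule that)
    have "eventually (\<lambda>n. n \<in> B \<and> n \<in> - nbhd f A \<and> N \<le> n) V"
      using B(1) C free_ultrafilter_ge[OF assms(3), of N]
      by (simp add: members_def eventually_conj_iff)
    then obtain m where m: "m \<in> B" "m \<notin> nbhd f A" "N \<le> m"
      using eventually_happens'[of V] assms(3) unfolding free_ultrafilter_def by blast
    then have "\<phi> m \<in> \<phi> ` {a \<in> A. N \<le> a}"
      unfolding B(2) by simp
    then obtain a where "a \<in> A" "N \<le> a" "\<phi> a = \<phi> m"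
      by (elim imageE) auto
    then show False
      using m le[of m a] le[of a m] by (auto simp: nbhd_def)
  qed
  with f(1) that show ?thesis by blast
qed

text \<open>A gap bound computed from \<open>f\<close> and \<open>E\<close> alone, so that one
  function serves every \<open>A\<close> with almost all of \<open>E\<close> in
  \<open>nbhd f A\<close>.\<close>

definition next_gap :: "(nat \<Rightarrow> nat) \<Rightarrow> nat set \<Rightarrow> nat \<Rightarrow> nat" where
  "next_gap f E n = running_max f (LEAST m. m \<in> E \<and> n < m \<and> running_max f n < m)"

text \<open>The chosen \<open>m\<close> in \<open>E\<close> is close to some \<open>a\<close> in
  \<open>A\<close>. One half of closeness gives the upper bound on \<open>a\<close>; by the other,
  \<open>a < n\<close> would give \<open>m \<le> running_max f n\<close>.\<close>

lemma eventually_next_gap: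
  assumes "infinite E" "finite (E - nbhd f A)"
  shows "\<forall>\<^sub>F n in sequentially. \<exists>a\<in>A. n \<le> a \<and> a \<le> next_gap f E n"
proof -
  obtain M where M: "\<And>m. m \<in> E - nbhd f A \<Longrightarrow> m \<le> M"
    using assms(2) by (meson finite_nat_set_iff_bounded_le)
  have "\<exists>a\<in>A. n \<le> a \<and> a \<le> next_gap f E n" if "M \<le> n" for n
  proof -
    define m where "m = (LEAST m. m \<in> E \<and> n < m \<and> running_max f n < m)"
    obtain k where "k \<in> E" "max n (running_max f n) < k"
      using assms(1) infinite_nat_iff_unbounded by blast
    then have m: "m \<in> E" "n < m" "running_max f n < m"
      using LeastI[of "\<lambda>m. m \<in> E \<and> n < m \<and> running_max f n < m" k] by (auto simp: m_def)
    then have "m \<in> nbhd f A"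
      using M[of m] that by force
    then obtain a where a: "a \<in> A" "m \<le> running_max f a" "a \<le> running_max f m"
      by (auto simp: nbhd_def)
    have "n \<le> a"
      using a(2) m(3) mono_running_max[of a n f] by linarith
    with a show ?thesis by (auto simp: next_gap_def m_def)
  qed
  then show ?thesis by (auto simp: eventually_sequentially)
qed

lemma finite_has_greatest:
  assumes "finite T" "T \<noteq> {}" "T \<subseteq> A" "linear_order_on A r"
  shows "\<exists>s\<in>T. \<forall>t\<in>T. (t, s) \<in> r"
  using assms(1-3)
proof (induction rule: finite_ne_induct)
  case (singleton x)
  then show ?case
    using assms(4) by (auto simp: order_on_defs refl_on_def)
next
  case (insert x T)
  then obtain s where s: "s \<in> T" "\<forall>t\<in>T. (t, s) \<in> r" by auto
  have "(x, s) \<in> r \<or> (s, x) \<in> r" "(x, x) \<in> r"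
    using assms(4) insert s(1) by (auto simp: order_on_defs refl_on_def total_on_def)
  moreover have "trans r"
    using assms(4) by (simp add: order_on_defs)
  ultimately show ?case
    using s unfolding trans_def by (metis insert_iff)
qed

text \<open>If the gaps of \<open>U\<close> were not small, a recursion along a dominating family \<open>D\<close> of minimal
  cardinality would produce an ultrafilter that contains, for each \<open>f \<in> D\<close>, the complement of
  \<open>nbhd f A\<close> for some \<open>A \<in> U\<close>. The recursion cannot get stuck: otherwise the fewer than
  \<open>\<dd>\<close> many sets constructed so far would witness small gaps.\<close>

lemma NCF_small_gaps:
  assumes "NCF" "free_ultrafilter U"
  shows "small_gaps U"
proof (rule ccontr)
  assume not_small: "\<not> small_gaps U"
  obtain D :: "(nat \<Rightarrow> nat) set" where D: "dominating D"
    and minD: "\<And>S :: (nat \<Rightarrow> nat) set. |S| <o |D| \<Longrightarrow> small S"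
    using minimal_dominating by blast
  define r where "r = |D|"
  have wo: "well_order_on D r"
    unfolding r_def by (rule card_of_well_order_on)
  have field: "Field r = D"
    unfolding r_def by (rule Field_card_of)
  \<comment> \<open>\<open>R\<close> is an admissible value at stage \<open>f\<close> after the
    earlier values \<open>E\<close>. The guard \<open>f \<in> D\<close> makes every \<open>R\<close>
    admissible outside \<open>D\<close>, where the recursion must also choose.\<close>
  define P where "P E f R \<longleftrightarrow> (f \<in> D \<longrightarrow> (\<exists>A. eventually (\<lambda>n. n \<in> A) U \<and> R = - nbhd f A) \<and>
    (\<forall>T. finite T \<and> T \<subseteq> underS r f \<longrightarrow> infinite (R \<inter> (\<Inter>g\<in>T. E g))))" for E f R
  \<comment> \<open>The last index \<open>s\<close> of \<open>T\<close> sees all others as earlier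
    stages, so its own condition covers the whole intersection.\<close>
  have centered: "infinite (\<Inter>g\<in>T. E g)"
    if T: "finite T" "T \<subseteq> D" "\<And>g. g \<in> T \<Longrightarrow> P E g (E g)" for E T
  proof (cases "T = {}")
    case False
    then obtain s where s: "s \<in> T" "\<forall>t\<in>T. (t, s) \<in> r"
      using finite_has_greatest[OF T(1) False T(2)] wo by (auto simp: well_order_on_def)
    then have "T - {s} \<subseteq> underS r s" "s \<in> D"
      using T(2) by (auto simp: underS_def)
    then have "infinite (E s \<inter> (\<Inter>g\<in>T - {s}. E g))"
      using T(3)[OF s(1)] T(1) unfolding P_def by blast
    moreover have "(\<Inter>g\<in>T. E g) = E s \<inter> (\<Inter>g\<in>T - {s}. E g)"
      using s(1) by auto
    ultimately show ?thesis by simp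
  qed auto
  have "\<exists>E. \<forall>f. P E f (E f)"
  proof (rule dependent_wf_choice)
    show "wf (r - Id)"
      using wo by (simp add: well_order_on_def)
  next
    fix E E' :: "(nat \<Rightarrow> nat) \<Rightarrow> nat set" and f R
    assume "\<And>g. (g, f) \<in> r - Id \<Longrightarrow> E g = E' g"
    then have "(\<Inter>g\<in>T. E g) = (\<Inter>g\<in>T. E' g)" if "T \<subseteq> underS r f" for T
      using that by (intro INF_cong) (auto simp: underS_def)
    then show "P E f R = P E' f R"
      unfolding P_def by metis
  next
    fix f E
    assume IH: "\<And>g. (g, f) \<in> r - Id \<Longrightarrow> P E g (E g)"
    show "\<exists>R. P E f R"
    proof (rule ccontr)
      assume no: "\<nexists>R. P E f R"
      then have fD: "f \<in> D"
        by (auto simp: P_def)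
      have under: "underS r f \<subseteq> D"
        unfolding field[symmetric] by (auto simp: underS_def Field_def)
      have "|underS r f| <o r"
        using card_of_underS[of r f] fD field by (simp add: r_def card_of_Card_order)
      then have "small (underS r f)"
        by (intro minD) (simp add: r_def)
      \<comment> \<open>If stage \<open>f\<close> is stuck, each \<open>A\<close> in
        \<open>U\<close> has a finite set \<open>T\<close> of earlier stages whose intersection lies
        almost inside \<open>nbhd f A\<close>. The candidate gap functions are thus indexed by
        finite sets of earlier stages.\<close>
      then have "small ((\<lambda>T. next_gap f (\<Inter>g\<in>T. E g)) ` Fpow (underS r f))"
        by (intro small_image small_Fpow)
      moreover have "\<exists>h\<in>(\<lambda>T. next_gap f (\<Inter>g\<in>T. E g)) ` Fpow (underS r f).
          \<forall>\<^sub>F n in sequentially. \<exists>a\<in>A. n \<le> a \<and> a \<le> h n"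
        if A: "eventually (\<lambda>n. n \<in> A) U" for A
      proof -
        obtain T where T: "finite T" "T \<subseteq> underS r f" "finite (- nbhd f A \<inter> (\<Inter>g\<in>T. E g))"
          using no A unfolding P_def by blast
        have "infinite (\<Inter>g\<in>T. E g)"
          using T under by (intro centered IH) (auto simp: underS_def)
        then have "\<forall>\<^sub>F n in sequentially. \<exists>a\<in>A. n \<le> a \<and> a \<le> next_gap f (\<Inter>g\<in>T. E g) n"
          using T(3) by (intro eventually_next_gap) (simp_all add: Diff_eq Int_commute)
        then show ?thesis
          using T by (auto simp: Fpow_def)
      qed
      ultimately show False
        using not_small unfolding small_gaps_def by blast
    qed
  qed
  then obtain E where E: "\<And>f. P E f (E f)" by blast
  have "\<exists>V. free_ultrafilter V \<and> (\<forall>f\<in>D. eventually (\<lambda>n. n \<in> E f) V)"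
    by (intro free_ultrafilter_extends centered E)
  then obtain V where V: "free_ultrafilter V" "\<And>f. f \<in> D \<Longrightarrow> eventually (\<lambda>n. n \<in> E f) V"
    by blast
  have "nearly_coherent U V"
    using assms V(1) by (simp add: NCF_def)
  then obtain f where f: "f \<in> D"
    "\<And>A. eventually (\<lambda>n. n \<in> A) U \<Longrightarrow> \<not> eventually (\<lambda>n. n \<in> - nbhd f A) V"
    using nearly_coherent_nbhd assms(2) V(1) D by metis
  then show False
    using E[of f] V(2)[of f] unfolding P_def by metis
qed

section \<open>Transfer of boundedness between ultrafilters\<close>

lemma NCF_bounded_transfer:
  fixes R :: "(nat \<Rightarrow> nat) set"
  assumes "NCF" "free_ultrafilter U" "free_ultrafilter W"
    and mono: "\<And>f. f \<in> R \<Longrightarrow> mono f"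
    and g: "\<And>f. f \<in> R \<Longrightarrow> eventually (\<lambda>n. f n \<le> g n) W"
  shows "\<exists>p. \<forall>f\<in>R. eventually (\<lambda>n. f n \<le> p n) U"
proof -
  obtain H where H: "small H" "\<And>A. eventually (\<lambda>n. n \<in> A) W \<Longrightarrow>
      \<exists>h\<in>H. \<forall>\<^sub>F n in sequentially. \<exists>a\<in>A. n \<le> a \<and> a \<le> h n"
    using NCF_small_gaps[OF assms(1,3)] unfolding small_gaps_def by blast
  obtain K where K: "small K" "\<And>A. eventually (\<lambda>n. n \<in> A) U \<Longrightarrow>
      \<exists>h\<in>K. \<forall>\<^sub>F n in sequentially. \<exists>a\<in>A. n \<le> a \<and> a \<le> h n"
    using NCF_small_gaps[OF assms(1,2)] unfolding small_gaps_def by blast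
  \<comment> \<open>If \<open>f a \<le> g a\<close> for some \<open>a\<close> in
    \<open>[n, h n]\<close>, monotonicity gives
    \<open>f n \<le> f a \<le> g a \<le> q h n\<close>.\<close>
  define q where "q h n = running_max g (h n)" for h :: "nat \<Rightarrow> nat" and n
  have R: "\<exists>h\<in>H. \<forall>\<^sub>F n in sequentially. f n \<le> q h n" if f: "f \<in> R" for f
  proof -
    obtain h where "h \<in> H"
      and h: "\<forall>\<^sub>F n in sequentially. \<exists>a\<in>{n. f n \<le> g n}. n \<le> a \<and> a \<le> h n"
      using H(2)[of "{n. f n \<le> g n}"] g[OF f] by auto
    have "f n \<le> q h n" if "f a \<le> g a" "n \<le> a" "a \<le> h n" for a n
      using that monoD[OF mono[OF f], of n a] le_running_max[of a "h n" g] by (auto simp: q_def)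
    then have "\<forall>\<^sub>F n in sequentially. f n \<le> q h n"
      using h by (auto elim!: eventually_mono)
    with \<open>h \<in> H\<close> show ?thesis by blast
  qed
  have "\<exists>p. \<forall>h\<in>H. eventually (\<lambda>n. q h n \<le> p n) U"
  proof (rule ccontr)
    assume unb: "\<nexists>p. \<forall>h\<in>H. eventually (\<lambda>n. q h n \<le> p n) U"
    \<comment> \<open>Given \<open>p\<close>, some \<open>q h\<close> exceeds
      \<open>running_max p\<close> on a set in \<open>U\<close>. With \<open>k\<close> bounding the
      gaps of that set, the point \<open>a\<close> in \<open>[n, k n]\<close> gives \<open>p n \<le>
      running_max p a < q h a \<le> running_max (q h) (k n)\<close>.\<close>
    define Q where "Q = (\<lambda>(h, k) n. running_max (q h) (k n)) ` (H \<times> K)"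
    have "dominating Q"
      unfolding dominating_def
    proof
      fix p
      obtain h where h: "h \<in> H" "\<not> eventually (\<lambda>n. q h n \<le> running_max p n) U"
        using unb by blast
      then have "eventually (\<lambda>n. \<not> q h n \<le> running_max p n) U"
        using assms(2) unfolding free_ultrafilter_def by blast
      then have "eventually (\<lambda>n. n \<in> {n. running_max p n < q h n}) U"
        by (simp add: not_le)
      then obtain k where "k \<in> K"
        and k: "\<forall>\<^sub>F n in sequentially. \<exists>a\<in>{n. running_max p n < q h n}. n \<le> a \<and> a \<le> k n"
        using K(2) by blast
      have "p n \<le> running_max (q h) (k n)" if "running_max p a < q h a" "n \<le> a" "a \<le> k n" for a n
        using that le_running_max[of n a p] le_running_max[of a "k n" "q h"] by linarith
      then have "\<forall>\<^sub>F n in sequentially. p n \<le> running_max (q h) (k n)"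
        using k by (auto elim!: eventually_mono)
      then show "\<exists>f\<in>Q. \<forall>\<^sub>F n in sequentially. p n \<le> f n"
        using h(1) \<open>k \<in> K\<close> unfolding Q_def by force
    qed
    moreover have "small Q"
      unfolding Q_def by (intro small_image small_Times H K)
    ultimately show False
      using small_not_dominating by blast
  qed
  then obtain p where p: "\<And>h. h \<in> H \<Longrightarrow> eventually (\<lambda>n. q h n \<le> p n) U" by blast
  have "U \<le> sequentially"
    using assms(2) by (simp add: free_ultrafilter_def cofinite_eq_sequentially)
  then have "eventually (\<lambda>n. f n \<le> p n) U" if f: "f \<in> R" for f
  proof -
    obtain h where h: "h \<in> H" "\<forall>\<^sub>F n in sequentially. f n \<le> q h n"
      using R[OF f] by blast
    have "eventually (\<lambda>n. f n \<le> q h n) U"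
      using h(2) \<open>U \<le> sequentially\<close> by (simp add: le_filter_def)
    with p[OF h(1)] show ?thesis
      by eventually_elim simp
  qed
  then show ?thesis by blast
qed

section \<open>Scheepers spaces\<close>

lemma Scheepers_spaceE:
  assumes "Scheepers_space X" "\<And>n. open_cover X (\<U> n)"
  obtains \<F> :: "nat \<Rightarrow> 'a set set" where "\<And>n. finite (\<F> n)" "\<And>n. \<F> n \<subseteq> \<U> n"
    "\<And>F. finite F \<Longrightarrow> F \<subseteq> topspace X \<Longrightarrow> \<exists>n. F \<subseteq> \<Union>(\<F> n)"
proof -
  obtain \<F> where "\<forall>n. finite (\<F> n) \<and> \<F> n \<subseteq> \<U> n"
    "\<forall>F. finite F \<and> F \<subseteq> topspace X \<longrightarrow> (\<exists>n. F \<subseteq> \<Union>(\<F> n))"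
    using assms(1)[unfolded Scheepers_space_def, THEN spec, of \<U>, THEN mp, OF allI[OF assms(2)]]
    by (elim exE conjE) (rule that)
  then show ?thesis
    by (intro that[of \<F>]) simp_all
qed

text \<open>Apply the property to a constant sequence of covers and to singletons. A nonempty space
  ensures a nonempty selection, which a sequence can enumerate.\<close>

lemma Scheepers_space_countable_subcover:
  assumes "Scheepers_space X" "open_cover X \<U>" "topspace X \<noteq> {}"
  obtains c :: "nat \<Rightarrow> 'a set" where "range c \<subseteq> \<U>" "\<Union>(range c) = topspace X"
proof -
  obtain \<F> where \<F>: "\<And>n::nat. finite (\<F> n)" "\<And>n. \<F> n \<subseteq> \<U>"
    "\<And>F. finite F \<Longrightarrow> F \<subseteq> topspace X \<Longrightarrow> \<exists>n. F \<subseteq> \<Union>(\<F> n)"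
    by (rule Scheepers_spaceE[OF assms(1), of "\<lambda>_. \<U>"]) (use assms(2) in blast)+
  define S where "S = (\<Union>n. \<F> n)"
  have S: "countable S" "S \<subseteq> \<U>"
    using \<F>(1,2) by (auto simp: S_def countable_finite)
  have "topspace X \<subseteq> \<Union>S"
    using \<F>(3)[of "{x}" for x] by (fastforce simp: S_def)
  then have cover: "\<Union>S = topspace X"
    using Union_mono[OF S(2)] assms(2) unfolding open_cover_def by simp
  then have "S \<noteq> {}"
    using assms(3) by (metis Union_empty)
  then have "range (from_nat_into S) = S"
    using S(1) by (simp add: range_from_nat_into)
  then show ?thesis
    using that[of "from_nat_into S"] S(2) cover by simp
qed

text \<open>The Scheepers property is applied to all tails of the sequence of covers, which makes \<open>m\<close>
  arbitrarily large; this is what gives a free ultrafilter later.\<close>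

lemma Scheepers_space_increasing:
  assumes X: "Scheepers_space X"
    and cover: "\<And>n. open_cover X (range (V n))"
    and inc: "\<And>n i j. i \<le> j \<Longrightarrow> V n i \<subseteq> V n j"
  shows "\<exists>g :: nat \<Rightarrow> nat. \<forall>F k. finite F \<longrightarrow> F \<subseteq> topspace X \<longrightarrow> (\<exists>m\<ge>k. F \<subseteq> V m (g m))"
proof -
  have "\<exists>G. \<forall>F. finite F \<and> F \<subseteq> topspace X \<longrightarrow> (\<exists>n. F \<subseteq> V (n + k) (G n))" for k
  proof -
    obtain \<F> where \<F>: "\<And>n. finite (\<F> n)" "\<And>n. \<F> n \<subseteq> range (V (n + k))"
      "\<And>F. finite F \<Longrightarrow> F \<subseteq> topspace X \<Longrightarrow> \<exists>n. F \<subseteq> \<Union>(\<F> n)"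
      by (rule Scheepers_spaceE[OF X, of "\<lambda>n. range (V (n + k))"]) (use cover in blast)+
    have "\<exists>b. \<Union>(\<F> n) \<subseteq> V (n + k) b" for n
    proof -
      obtain I where I: "finite I" "\<F> n = V (n + k) ` I"
        using finite_subset_image[OF \<F>(1) \<F>(2), of n] by auto
      then obtain b where b: "\<And>i. i \<in> I \<Longrightarrow> i \<le> b"
        using Max_ge[OF I(1)] by blast
      have "\<Union>(\<F> n) \<subseteq> V (n + k) b"
        unfolding I(2) by (intro Union_least, elim imageE) (simp add: inc b)
      then show ?thesis ..
    qed
    then obtain G where G: "\<And>n. \<Union>(\<F> n) \<subseteq> V (n + k) (G n)" by metis
    have "\<exists>n. F \<subseteq> V (n + k) (G n)" if F: "finite F" "F \<subseteq> topspace X" for F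
      using \<F>(3)[OF F] order_trans[OF _ G] by fast
    then show ?thesis by blast
  qed
  then obtain G where G: "\<And>k F. finite F \<Longrightarrow> F \<subseteq> topspace X \<Longrightarrow> \<exists>n. F \<subseteq> V (n + k) (G k n)"
    by metis
  \<comment> \<open>Stage \<open>m\<close> is stage \<open>m - k\<close> of the tail starting at
    \<open>k\<close>; the maximum serves all tails with \<open>k \<le> m\<close> at once.\<close>
  define g where "g m = Max ((\<lambda>k. G k (m - k)) ` {..m})" for m
  have "\<exists>m\<ge>k. F \<subseteq> V m (g m)" if F: "finite F" "F \<subseteq> topspace X" for F k
  proof -
    obtain n where n: "F \<subseteq> V (n + k) (G k n)"
      using G[OF F] by blast
    have "G k n \<le> g (n + k)"
      unfolding g_def by (intro Max_ge) (auto intro!: image_eqI[of _ _ k])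
    then show ?thesis
      using order_trans[OF n inc] by (intro exI[of _ "n + k"]) simp
  qed
  then show ?thesis by blast
qed

section \<open>The Scheepers property and U-Menger under NCF\<close>

lemma NCF_Scheepers_imp_Menger:
  assumes "NCF" "free_ultrafilter U" and X: "Scheepers_space X"
  shows "Menger_wrt U X"
  unfolding Menger_wrt_def
proof (intro allI impI)
  fix \<U> :: "nat \<Rightarrow> 'a set set"
  assume \<U>: "\<forall>n. open_cover X (\<U> n)"
  show "\<exists>\<F>. (\<forall>n. finite (\<F> n) \<and> \<F> n \<subseteq> \<U> n) \<and>
    (\<forall>x\<in>topspace X. {n. x \<in> \<Union>(\<F> n)} \<in> members U)"
  proof (cases "topspace X = {}")
    case True
    then show ?thesis by (intro exI[of _ "\<lambda>_. {}"]) auto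
  next
    case False
    have "\<exists>c :: nat \<Rightarrow> 'a set. range c \<subseteq> \<U> n \<and> \<Union>(range c) = topspace X" for n
      using Scheepers_space_countable_subcover[OF X _ False] \<U> by metis
    then obtain c :: "nat \<Rightarrow> nat \<Rightarrow> 'a set" where
      c: "\<And>n. range (c n) \<subseteq> \<U> n" "\<And>n. \<Union>(range (c n)) = topspace X"
      by metis
    \<comment> \<open>Unions over \<open>j \<le> i\<close> make \<open>V\<close> increasing in
      \<open>i\<close>; intersections over \<open>k \<le> n\<close> make it decreasing in
      \<open>n\<close>, so that the first-stage functions \<open>f x\<close> below are
      increasing.\<close>
    define V where "V n i = (\<Inter>k\<le>n. \<Union>j\<le>i. c k j)" for n i
    have inc: "V n i \<subseteq> V n j" if "i \<le> j" for n i j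
      using that by (fastforce simp: V_def)
    have dec: "V n i \<subseteq> V m i" if "m \<le> n" for m n i
      using that by (fastforce simp: V_def)
    have ex: "\<exists>i. x \<in> V n i" if x: "x \<in> topspace X" for x n
    proof -
      have "\<exists>j. x \<in> c k j" for k
        using c(2)[of k] x by auto
      then obtain s where s: "\<And>k. x \<in> c k (s k)" by metis
      then have "x \<in> V n (running_max s n)"
        using le_running_max[of _ n s] by (auto simp: V_def)
      then show ?thesis ..
    qed
    have op: "openin X (V n i)" for n i
    proof -
      have "openin X (c k j)" for k j
        using c(1)[of k] \<U> by (auto simp: open_cover_def)
      then show ?thesis
        unfolding V_def by (intro openin_INT2 openin_Union) auto
    qed
    have cover: "open_cover X (range (V n))" for n
      unfolding open_cover_def using op[of n] openin_subset[OF op[of n]] ex[of _ n]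
      by (intro conjI subset_antisym) auto
    have "\<exists>g. \<forall>F k. finite F \<longrightarrow> F \<subseteq> topspace X \<longrightarrow> (\<exists>m\<ge>k. F \<subseteq> V m (g m))"
      using X cover inc by (rule Scheepers_space_increasing)
    then obtain g where
      g: "\<And>F k. finite F \<Longrightarrow> F \<subseteq> topspace X \<Longrightarrow> \<exists>m\<ge>k. F \<subseteq> V m (g m)"
      by blast
    \<comment> \<open>Infinitude comes from \<open>g\<close> providing witnesses \<open>m\<close>
      beyond every \<open>k\<close>.\<close>
    have "infinite (\<Inter>x\<in>F. {m. x \<in> V m (g m)})" if "finite F" "F \<subseteq> topspace X" for F
      unfolding infinite_nat_iff_unbounded_le using g[OF that] by fastforce
    then have "\<exists>W. free_ultrafilter W \<and>
        (\<forall>x\<in>topspace X. eventually (\<lambda>m. m \<in> {m. x \<in> V m (g m)}) W)"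
      by (rule free_ultrafilter_extends)
    then obtain W where W: "free_ultrafilter W"
      "\<And>x. x \<in> topspace X \<Longrightarrow> eventually (\<lambda>m. x \<in> V m (g m)) W"
      by auto
    define f where "f x n = (LEAST i. x \<in> V n i)" for x n
    have f_le: "f x n \<le> i" if "x \<in> V n i" for x n i
      unfolding f_def using that by (rule Least_le)
    have in_V: "x \<in> V n (f x n)" if "x \<in> topspace X" for x n
      unfolding f_def using cover[of n] that by (auto simp: open_cover_def intro: LeastI)
    have mono: "mono (f x)" if "x \<in> topspace X" for x
      by (intro monoI f_le subsetD[OF dec in_V[OF that]])
    have bound: "eventually (\<lambda>n. f x n \<le> g n) W" if "x \<in> topspace X" for x
      using W(2)[OF that] by eventually_elim (auto intro: f_le)
    have "\<exists>p. \<forall>h\<in>f ` topspace X. eventually (\<lambda>n. h n \<le> p n) U"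
      using mono bound by (intro NCF_bounded_transfer[OF assms(1,2) W(1), of _ g]) auto
    then obtain p where p: "\<And>x. x \<in> topspace X \<Longrightarrow> eventually (\<lambda>n. f x n \<le> p n) U"
      by auto
    have "{n. x \<in> \<Union>(c n ` {..p n})} \<in> members U" if x: "x \<in> topspace X" for x
    proof -
      have "x \<in> \<Union>(c n ` {..p n})" if "f x n \<le> p n" for n
      proof -
        \<comment> \<open>Use the factor \<open>k = n\<close> of the intersection defining
          \<open>V n (f x n)\<close>.\<close>
        have "x \<in> (\<Union>j\<le>f x n. c n j)"
          using in_V[OF x, of n] unfolding V_def by blast
        with that show ?thesis by force
      qed
      then show ?thesis
        using eventually_mono[OF p[OF x]] unfolding members_def by simp
    qed
    then show ?thesis
      by (intro exI[of _ "\<lambda>n. c n ` {..p n}"]) (auto intro: subsetD[OF c(1)])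
  qed
qed

text \<open>The sets of indices for the finitely many points of \<open>F\<close> meet in a member of
  \<open>U\<close>, which is nonempty since \<open>U\<close> is proper.\<close>

lemma Menger_imp_Scheepers:
  assumes "U \<noteq> bot" "Menger_wrt U X"
  shows "Scheepers_space X"
  unfolding Scheepers_space_def
proof (intro allI impI)
  fix \<U> :: "nat \<Rightarrow> 'a set set"
  assume "\<forall>n. open_cover X (\<U> n)"
  from assms(2)[unfolded Menger_wrt_def, THEN spec, THEN mp, OF this]
  obtain \<F> where \<F>: "\<forall>n. finite (\<F> n) \<and> \<F> n \<subseteq> \<U> n"
    "\<And>x. x \<in> topspace X \<Longrightarrow> eventually (\<lambda>n. x \<in> \<Union>(\<F> n)) U"
    unfolding members_def by auto
  have "\<exists>n. F \<subseteq> \<Union>(\<F> n)" if "finite F" "F \<subseteq> topspace X" for F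
  proof -
    have "eventually (\<lambda>n. \<forall>x\<in>F. x \<in> \<Union>(\<F> n)) U"
      using that \<F>(2) by (intro eventually_ball_finite) auto
    then show ?thesis
      using eventually_happens'[OF assms(1)] by blast
  qed
  with \<F>(1) show "\<exists>\<F>. (\<forall>n. finite (\<F> n) \<and> \<F> n \<subseteq> \<U> n) \<and>
    (\<forall>F. finite F \<and> F \<subseteq> topspace X \<longrightarrow> (\<exists>n. F \<subseteq> \<Union>(\<F> n)))"
    by blast
qed

theorem lemma6p1:
  assumes "NCF"
  shows "(\<forall>X :: 'a topology. infinite_Tychonoff_space X \<and> Scheepers_space X \<longrightarrow>
            (\<forall>U. free_ultrafilter U \<longrightarrow> Menger_wrt U X)) \<and>
         (\<forall>U V. free_ultrafilter U \<longrightarrow> free_ultrafilter V \<longrightarrow>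
            (\<forall>X :: 'a topology. infinite_Tychonoff_space X \<longrightarrow>
               (Menger_wrt U X \<longleftrightarrow> Menger_wrt V X)))"
proof -
  \<comment> \<open>The left side does not mention \<open>U\<close>, so any two of the properties on
    the right agree.\<close>
  have "Scheepers_space X \<longleftrightarrow> Menger_wrt U X" if "free_ultrafilter U" for U and X :: "'a topology"
    using NCF_Scheepers_imp_Menger[OF assms that] Menger_imp_Scheepers[of U X] that
    by (auto simp: free_ultrafilter_def)
  then show ?thesis by metis
qed

end
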